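(* Let $T_n(z)=T_n^{(0)}-zT_n^{(1)}$ with tridiagonal matrices $T_n^{(0)},T_n^{(1)}\in\mathbb{C}^{(n+1)\times(n+1)}$, and assume that $\det(T_n(z))\not\equiv0$ as a function of $z$. Let $U,V$ and $J(\tau_j,n_j^{(0)})$ ($j=1,\dots,k_0$), $J(0,n_j^{(1)})$ ($j=1,\dots,k_1$) be the matrices and parameters of the Weierstrass canonical form of the pencil $T_n^{(0)}-zT_n^{(1)}$, that is, $U,V\in\mathbb{C}^{(n+1)\times(n+1)}$ are nonsingular and $$U(T_n^{(0)}-zT_n^{(1)})V=\begin{bmatrix}J^{(0)}-zI_{n^{(0)}}\\ & I_{n^{(1)}}-zJ^{(1)}\end{bmatrix},\quad J^{(0)}=\bigoplus_{j=1}^{k_0}J(\tau_j,n_j^{(0)}),\quad J^{(1)}=\bigoplus_{j=1}^{k_1}J(0,n_j^{(1)}).$$ Let $u=Ue_1$ and $v^{\mathsf{T}}=e_1^{\mathsf{T}}V$, and let $u^{(j)}$ and $(v^{(j)})^{\mathsf{T}}$, $j=1,\dots,k_0+k_1$, denote the blocks of $u$ and $v^{\mathsf{T}}$ corresponding to block $j$ of the Weierstrass canonical form. Then $$e_1^{\mathsf{T}}T_n(z)^{-1}e_1=\sum_{j=1}^{k_0}\sum_{i=0}^{n_j^{(0)}-1}\frac{-\omega_{j,i}}{(z-\tau_j)^{i+1}}+\sum_{j=1}^{k_1}\sum_{i=0}^{n_j^{(1)}-1}z^i\sigma_{j,i},$$ where $$\omega_{j,i}=(v^{(j)})^{\mathsf{T}}\big(S_{n_j^{(0)}}\big)^iu^{(j)},\qquad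 \sigma_{j,i}=(v^{(k_0+j)})^{\mathsf{T}}\big(S_{n_j^{(1)}}\big)^iu^{(k_0+j)}.$$
   Context: $e_1$ is the first unit vector in $\mathbb{C}^{n+1}$. $S_m\in\mathbb{C}^{m\times m}$ is the nilpotent shift matrix with ones on the first superdiagonal and zeros elsewhere, and $J(\mu,m)=\mu I_m+S_m$ is the Jordan block of size $m$ with eigenvalue $\mu\in\mathbb{C}$. $n^{(i)}=\sum_{j=1}^{k_i}n_j^{(i)}$ for $i=0,1$, and $n^{(0)}+n^{(1)}=n+1$. The Weierstrass canonical form exists for every pencil with $\det(T_n(z))\not\equiv0$. The blocks are numbered so that blocks $1,\dots,k_0$ are those of $J^{(0)}$ and blocks $k_0+1,\dots,k_0+k_1$ are those of $J^{(1)}$. The identity is one of rational functions in $z$ (i.e. for all $z$ with $\det T_n(z)\ne0$). *)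

theory Defs
  imports
    Complex_Main
    "Jordan_Normal_Form.Gauss_Jordan_Elimination"
    "Jordan_Normal_Form.Jordan_Normal_Form"
begin

definition tridiagonal_mat :: "'a :: zero mat \<Rightarrow> bool" where
  "tridiagonal_mat A \<longleftrightarrow>
     (\<forall>i < dim_row A. \<forall>j < dim_col A. i + 1 < j \<or> j + 1 < i \<longrightarrow> A $$ (i, j) = 0)"

definition shift_mat :: "nat \<Rightarrow> 'a :: {zero, one} mat" where
  "shift_mat m = mat m m (\<lambda>(i, j). if j = i + 1 then 1 else 0)"

lemma jordan_block_eq_shift_mat:
  "jordan_block m \<mu> = \<mu> \<cdot>\<^sub>m 1\<^sub>m m + shift_mat m" for \<mu> :: "'a :: comm_ring_1"
  by (rule eq_matI) (auto simp: shift_mat_def)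

text \<open>The inverse of a matrix \<open>A\<close> is written \<open>the (mat_inverse A)\<close>; this is meaningful exactly
  for nonsingular \<open>A\<close>.\<close>

lemma the_mat_inverse:
  fixes A :: "'a :: field mat"
  assumes A: "A \<in> carrier_mat n n" and d: "det A \<noteq> 0"
  shows "the (mat_inverse A) \<in> carrier_mat n n"
    and "A * the (mat_inverse A) = 1\<^sub>m n" and "the (mat_inverse A) * A = 1\<^sub>m n"
proof -
  have "A \<in> Units (ring_mat TYPE('a) n ())"
    by (rule det_non_zero_imp_unit[OF A d])
  then have "mat_inverse A \<noteq> None"
    using mat_inverse(1)[OF A] by metis
  then have "mat_inverse A = Some (the (mat_inverse A))"
    by simp
  from mat_inverse(2)[OF A this]
  show "the (mat_inverse A) \<in> carrier_mat n n"
    and "A * the (mat_inverse A) = 1\<^sub>m n" and "the (mat_inverse A) * A = 1\<^sub>m n"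
    by auto
qed

text \<open>The regular part of the pencil \<open>A - z B\<close> has \<open>k0\<close> Jordan blocks of sizes
  \<open>n0 1, \<dots>, n0 k0\<close> with eigenvalues \<open>\<tau> 1, \<dots>, \<tau> k0\<close>; the nilpotent part has \<open>k1\<close> Jordan blocks
  of sizes \<open>n1 1, \<dots>, n1 k1\<close>. Values of \<open>n0\<close>, \<open>\<tau>\<close> and \<open>n1\<close> at other indices are irrelevant.
  As in \<open>jordan_nf\<close>, Jordan blocks are nonempty.\<close>

definition weierstrass_form ::
  "complex mat \<Rightarrow> complex mat \<Rightarrow> nat \<Rightarrow> complex mat \<Rightarrow> complex mat \<Rightarrow>
   nat \<Rightarrow> (nat \<Rightarrow> nat) \<Rightarrow> (nat \<Rightarrow> complex) \<Rightarrow> nat \<Rightarrow> (nat \<Rightarrow> nat) \<Rightarrow> bool" where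
  "weierstrass_form A B N U V k0 n0 \<tau> k1 n1 \<longleftrightarrow>
     U \<in> carrier_mat N N \<and> V \<in> carrier_mat N N \<and> invertible_mat U \<and> invertible_mat V \<and>
     (\<forall>j \<in> {1..k0}. n0 j > 0) \<and> (\<forall>j \<in> {1..k1}. n1 j > 0) \<and>
     (\<Sum>j = 1..k0. n0 j) + (\<Sum>j = 1..k1. n1 j) = N \<and>
     (\<forall>z. U * (A - z \<cdot>\<^sub>m B) * V =
        diag_block_mat
          [jordan_matrix (map (\<lambda>j. (n0 j, \<tau> j)) [1..<k0 + 1]) - z \<cdot>\<^sub>m 1\<^sub>m (\<Sum>j = 1..k0. n0 j),
           1\<^sub>m (\<Sum>j = 1..k1. n1 j) - z \<cdot>\<^sub>m jordan_matrix (map (\<lambda>j. (n1 j, 0)) [1..<k1 + 1])])"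

definition block_size :: "nat \<Rightarrow> (nat \<Rightarrow> nat) \<Rightarrow> (nat \<Rightarrow> nat) \<Rightarrow> nat \<Rightarrow> nat" where
  "block_size k0 n0 n1 j = (if j \<le> k0 then n0 j else n1 (j - k0))"

text \<open>\<open>vec_block s x j\<close> is the \<open>j\<close>-th block (counted from 1) of \<open>x\<close> when \<open>x\<close> is partitioned into
  consecutive blocks of sizes \<open>s 1, s 2, \<dots>\<close>.\<close>

definition vec_block :: "(nat \<Rightarrow> nat) \<Rightarrow> 'a vec \<Rightarrow> nat \<Rightarrow> 'a vec" where
  "vec_block s x j = vec (s j) (\<lambda>i. x $ ((\<Sum>l = 1..<j. s l) + i))"

end

theory Submission
  imports Defs
begin

text \<open>
  Write \<open>D\<close> for the canonical form \<open>U T(z) V\<close>. Since \<open>U T(z) V D\<^sup>-\<^sup>1 = 1\<close> is an identity between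
  square matrices, \<open>U\<close> may be moved from the left end to the right one, which shows that
  \<open>T(z)\<^sup>-\<^sup>1 = V D\<^sup>-\<^sup>1 U\<close> (\<open>mat_inverse_of_equivalent\<close>). The wanted entry of \<open>T(z)\<^sup>-\<^sup>1\<close> is therefore the bilinear form
  \<open>v \<bullet> D\<^sup>-\<^sup>1 u\<close>.

  Now \<open>D\<close> is block diagonal, so the form splits into one summand for each Jordan block, with the
  corresponding pieces of \<open>v\<close> and \<open>u\<close> (\<open>scalar_prod_diag_block_mat\<close>). Up to a scalar, each
  block is \<open>1 - c S\<close> with a nilpotent shift \<open>S\<close>: the finite blocks are
  \<open>J(\<tau>, m) - z = (\<tau> - z) (1 - S / (z - \<tau>))\<close> and the infinite ones \<open>1 - z S\<close>. The Neumann series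
  \<open>(1 - c S)\<^sup>-\<^sup>1 = \<Sum>i<m. c\<^sup>i S\<^sup>i\<close> terminates because \<open>S\<^sup>m = 0\<close> (\<open>shift_neumann_inverse\<close>), and it
  turns the summands into the two inner sums of the formula.

  The scalar \<open>\<tau> - z\<close> is nonzero: \<open>det D = det U * det T(z) * det V\<close> is nonzero and has the
  determinant \<open>(\<tau> - z)\<^sup>m\<close> of every finite block as a factor, where \<open>m > 0\<close>.
\<close>

section \<open>Powers of the shift matrix and the terminating Neumann series\<close>

lemma shift_mat_carrier [simp]: "shift_mat m \<in> carrier_mat m m"
  by (simp add: shift_mat_def)

lemma shift_mat_power:
  "shift_mat m ^\<^sub>m i = mat m m (\<lambda>(a, b). if b = a + i then 1 else (0 :: 'a :: comm_ring_1))"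
proof (induction i)
  case 0
  show ?case by (rule eq_matI) (auto simp: shift_mat_def)
next
  case (Suc i)
  show ?case
  proof (rule eq_matI)
    fix a b assume "a < dim_row (mat m m (\<lambda>(a, b). if b = a + Suc i then 1 else (0 :: 'a)))"
      "b < dim_col (mat m m (\<lambda>(a, b). if b = a + Suc i then 1 else (0 :: 'a)))"
    then have ab: "a < m" "b < m" by auto
    have "(shift_mat m ^\<^sub>m Suc i) $$ (a, b) =
        (\<Sum>k<m. (if k = a + i then 1 else 0) * (if b = k + 1 then 1 else (0 :: 'a)))"
      using ab unfolding pow_mat.simps Suc.IH
      by (auto simp: scalar_prod_def shift_mat_def lessThan_atLeast0 intro!: sum.cong)
    also have "\<dots> = (\<Sum>k<m. if k = a + i then (if b = a + i + 1 then 1 else 0) else 0)"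
      by (intro sum.cong) auto
    also have "\<dots> = (if b = a + Suc i then 1 else 0)"
      using ab by (auto simp: sum.delta)
    finally show "(shift_mat m ^\<^sub>m Suc i) $$ (a, b) =
        mat m m (\<lambda>(a, b). if b = a + Suc i then 1 else (0 :: 'a)) $$ (a, b)"
      using ab by simp
  qed (auto simp: Suc.IH shift_mat_def)
qed

text \<open>This is \<open>\<Sum>i<m. c\<^sup>i S\<^sup>i\<close> for the shift \<open>S\<close> of size \<open>m\<close>, written out entrywise:
  matrices of all sizes share one type, which thus has no zero to start a \<open>sum\<close> from.\<close>

definition shift_neumann :: "nat \<Rightarrow> 'a :: comm_ring_1 \<Rightarrow> 'a mat" where
  "shift_neumann m c = mat m m (\<lambda>(a, b). if a \<le> b then c ^ (b - a) else 0)"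

lemma shift_neumann_carrier [simp]: "shift_neumann m c \<in> carrier_mat m m"
  by (simp add: shift_neumann_def)

lemma scalar_prod_shift_neumann:
  fixes u v :: "'a :: comm_ring_1 vec"
  assumes u: "u \<in> carrier_vec m" and v: "v \<in> carrier_vec m"
  shows "v \<bullet> (shift_neumann m c *\<^sub>v u) = (\<Sum>i<m. c ^ i * (v \<bullet> ((shift_mat m ^\<^sub>m i) *\<^sub>v u)))"
proof -
  have form: "v \<bullet> (mat m m f *\<^sub>v u) = (\<Sum>a<m. \<Sum>b<m. v $ a * f (a, b) * u $ b)" for f
    using u v by (auto simp: scalar_prod_def lessThan_atLeast0 sum_distrib_left mult.assoc
        intro!: sum.cong)
  have entry: "(if a \<le> b then c ^ (b - a) else 0) =
      (\<Sum>i<m. c ^ i * (if b = a + i then 1 else 0))" if "b < m" for a b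
  proof -
    have "(\<Sum>i<m. c ^ i * (if b = a + i then 1 else 0)) =
        (\<Sum>i<m. if i = b - a then (if a \<le> b then c ^ (b - a) else 0) else 0)"
      by (intro sum.cong) auto
    then show ?thesis using that by (auto simp: sum.delta)
  qed
  have "v \<bullet> (shift_neumann m c *\<^sub>v u) =
      (\<Sum>a<m. \<Sum>b<m. \<Sum>i<m. c ^ i * (v $ a * (if b = a + i then 1 else 0) * u $ b))"
    unfolding shift_neumann_def form
    by (intro sum.cong refl)
      (simp only: prod.case entry lessThan_iff sum_distrib_left sum_distrib_right mult_ac)
  also have "\<dots> = (\<Sum>a<m. \<Sum>i<m. \<Sum>b<m. c ^ i * (v $ a * (if b = a + i then 1 else 0) * u $ b))"
    by (intro sum.cong refl sum.swap)
  also have "\<dots> = (\<Sum>i<m. \<Sum>a<m. \<Sum>b<m. c ^ i * (v $ a * (if b = a + i then 1 else 0) * u $ b))"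
    by (rule sum.swap)
  also have "\<dots> = (\<Sum>i<m. c ^ i * (v \<bullet> ((shift_mat m ^\<^sub>m i) *\<^sub>v u)))"
    unfolding shift_mat_power form by (simp add: sum_distrib_left)
  finally show ?thesis .
qed

text \<open>Row \<open>a\<close> of \<open>S N\<close> is row \<open>a + 1\<close> of \<open>N\<close>, so the product telescopes: \<open>c\<close> times that row
  agrees with row \<open>a\<close> strictly right of the diagonal and vanishes elsewhere.\<close>

lemma shift_neumann_inverse:
  "(1\<^sub>m m - c \<cdot>\<^sub>m shift_mat m) * shift_neumann m c = (1\<^sub>m m :: 'a :: comm_ring_1 mat)"
proof (rule eq_matI)
  fix a b assume "a < dim_row (1\<^sub>m m :: 'a mat)" "b < dim_col (1\<^sub>m m :: 'a mat)"
  then have ab: "a < m" "b < m" by auto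
  define N where "N = (\<lambda>k. if k \<le> b then c ^ (b - k) else 0)"
  have "((1\<^sub>m m - c \<cdot>\<^sub>m shift_mat m) * shift_neumann m c) $$ (a, b) =
      (\<Sum>k<m. ((if a = k then 1 else 0) - c * (if k = a + 1 then 1 else 0)) * N k)"
    using ab by (auto simp: scalar_prod_def shift_mat_def shift_neumann_def N_def lessThan_atLeast0
        intro!: sum.cong)
  also have "\<dots> = (\<Sum>k<m. (if k = a then N a else 0) - (if k = a + 1 then c * N (a + 1) else 0))"
    by (intro sum.cong) auto
  also have "\<dots> = N a - (if a + 1 < m then c * N (a + 1) else 0)"
    using ab by (simp add: sum_subtractf sum.delta)
  also have "\<dots> = (if a = b then 1 else 0)"
  proof (cases "a < b")
    case True
    then have "b - a = Suc (b - Suc a)" by simp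
    then show ?thesis using True ab by (simp add: N_def)
  qed (use ab in \<open>auto simp: N_def\<close>)
  finally show "((1\<^sub>m m - c \<cdot>\<^sub>m shift_mat m) * shift_neumann m c) $$ (a, b) = 1\<^sub>m m $$ (a, b)"
    using ab by simp
qed (auto simp: shift_neumann_def shift_mat_def)

text \<open>The shifted Jordan block is \<open>(\<tau> - z) (1 - S / (z - \<tau>))\<close>, and the scalar becomes the factor
  \<open>- 1 / (z - \<tau>)\<close> of the inverse.\<close>

lemma jordan_block_resolvent:
  fixes \<tau> z :: "'a :: field"
  assumes "z \<noteq> \<tau>"
  shows "(jordan_block m \<tau> - z \<cdot>\<^sub>m 1\<^sub>m m) *
    ((- 1 / (z - \<tau>)) \<cdot>\<^sub>m shift_neumann m (1 / (z - \<tau>))) = 1\<^sub>m m"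
proof -
  let ?c = "1 / (z - \<tau>)"
  have eq: "jordan_block m \<tau> - z \<cdot>\<^sub>m 1\<^sub>m m = (\<tau> - z) \<cdot>\<^sub>m (1\<^sub>m m - ?c \<cdot>\<^sub>m shift_mat m)"
    using assms by (intro eq_matI) (auto simp: shift_mat_def field_simps)
  have A: "1\<^sub>m m - ?c \<cdot>\<^sub>m shift_mat m \<in> carrier_mat m m"
    by (auto simp: shift_mat_def)
  have "(\<tau> - z) * (- 1 / (z - \<tau>)) = 1" using assms by (simp add: field_simps)
  moreover have "(\<tau> - z) \<cdot>\<^sub>m (1\<^sub>m m - ?c \<cdot>\<^sub>m shift_mat m) * ((- 1 / (z - \<tau>)) \<cdot>\<^sub>m shift_neumann m ?c) =
      ((\<tau> - z) * (- 1 / (z - \<tau>))) \<cdot>\<^sub>m ((1\<^sub>m m - ?c \<cdot>\<^sub>m shift_mat m) * shift_neumann m ?c)"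
    using mult_smult_assoc_mat[OF A smult_carrier_mat[OF shift_neumann_carrier]]
      mult_smult_distrib[OF A shift_neumann_carrier] by (intro eq_matI) (simp_all add: mult.assoc)
  ultimately show ?thesis
    unfolding eq shift_neumann_inverse by (intro eq_matI) simp_all
qed

lemma det_jordan_block_minus_eigenvalue:
  assumes "m > 0"
  shows "det (jordan_block m \<tau> - \<tau> \<cdot>\<^sub>m 1\<^sub>m m) = (0 :: 'a :: idom)"
proof -
  have "det (jordan_block m \<tau> - \<tau> \<cdot>\<^sub>m 1\<^sub>m m) = prod_list (diag_mat (jordan_block m \<tau> - \<tau> \<cdot>\<^sub>m 1\<^sub>m m))"
    by (rule det_upper_triangular[where n = m]) (auto simp: upper_triangular_def)
  also have "\<dots> = (\<Prod>i\<leftarrow>[0..<m]. 0)"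
    by (auto simp: diag_mat_def intro!: arg_cong[of _ _ prod_list])
  finally show ?thesis using assms by (simp add: prod_list_zero_iff)
qed

section \<open>Block diagonal matrices\<close>

lemma diag_block_mat_append_pair:
  "diag_block_mat (As @ Bs) = diag_block_mat [diag_block_mat As, diag_block_mat Bs]"
  by (simp only: diag_block_mat_append diag_block_mat.simps(2)[of _ "[_]"]
      diag_block_mat_singleton Let_def)

lemma diag_block_mat_map_carrier:
  assumes "\<And>j. j \<in> set js \<Longrightarrow> A j \<in> carrier_mat (s j) (s j)"
  shows "diag_block_mat (map A js) \<in> carrier_mat (\<Sum>j\<leftarrow>js. s j) (\<Sum>j\<leftarrow>js. s j)"
proof -
  have "map (dim_row \<circ> A) js = map s js" "map (dim_col \<circ> A) js = map s js"
    using assms by (intro map_cong refl; fastforce)+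
  then show ?thesis by (intro carrier_matI) (simp_all only: dim_diag_block_mat map_map)
qed

lemma diag_block_mat_map_minus_smult:
  fixes A B :: "'b \<Rightarrow> 'a :: ring mat"
  assumes "\<And>j. j \<in> set js \<Longrightarrow> A j \<in> carrier_mat (s j) (s j)"
    and "\<And>j. j \<in> set js \<Longrightarrow> B j \<in> carrier_mat (s j) (s j)"
  shows "diag_block_mat (map A js) - c \<cdot>\<^sub>m diag_block_mat (map B js) =
    diag_block_mat (map (\<lambda>j. A j - c \<cdot>\<^sub>m B j) js)"
  using assms
proof (induction js)
  case Nil
  show ?case by (rule eq_matI) auto
next
  case (Cons j js)
  let ?S = "\<Sum>j\<leftarrow>js. s j"
  have A: "diag_block_mat (map A js) \<in> carrier_mat ?S ?S"
    and B: "diag_block_mat (map B js) \<in> carrier_mat ?S ?S"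
    using Cons.prems by (auto intro!: diag_block_mat_map_carrier)
  have IH: "diag_block_mat (map A js) - c \<cdot>\<^sub>m diag_block_mat (map B js) =
      diag_block_mat (map (\<lambda>j. A j - c \<cdot>\<^sub>m B j) js)"
    using Cons by simp
  have "A j \<in> carrier_mat (s j) (s j)" "B j \<in> carrier_mat (s j) (s j)"
    using Cons.prems by auto
  with A B show ?case
    by (intro eq_matI) (auto simp: Let_def IH[symmetric])
qed

lemma diag_block_mat_map_mult:
  fixes A B :: "'b \<Rightarrow> 'a :: comm_ring_1 mat"
  assumes "\<And>j. j \<in> set js \<Longrightarrow> A j \<in> carrier_mat (s j) (s j)"
    and "\<And>j. j \<in> set js \<Longrightarrow> B j \<in> carrier_mat (s j) (s j)"
  shows "diag_block_mat (map A js) * diag_block_mat (map B js) =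
    diag_block_mat (map (\<lambda>j. A j * B j) js)"
  using assms
proof (induction js)
  case Nil
  show ?case by (rule eq_matI) auto
next
  case (Cons j js)
  let ?S = "\<Sum>j\<leftarrow>js. s j"
  have A: "diag_block_mat (map A js) \<in> carrier_mat ?S ?S"
    and B: "diag_block_mat (map B js) \<in> carrier_mat ?S ?S"
    using Cons.prems by (auto intro!: diag_block_mat_map_carrier)
  have IH: "diag_block_mat (map A js) * diag_block_mat (map B js) =
      diag_block_mat (map (\<lambda>j. A j * B j) js)"
    using Cons by simp
  have Aj: "A j \<in> carrier_mat (s j) (s j)" and Bj: "B j \<in> carrier_mat (s j) (s j)"
    using Cons.prems by auto
  have "four_block_mat (A j) (0\<^sub>m (s j) ?S) (0\<^sub>m ?S (s j)) (diag_block_mat (map A js)) *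
      four_block_mat (B j) (0\<^sub>m (s j) ?S) (0\<^sub>m ?S (s j)) (diag_block_mat (map B js)) =
      four_block_mat (A j * B j) (0\<^sub>m (s j) ?S) (0\<^sub>m ?S (s j))
        (diag_block_mat (map (\<lambda>j. A j * B j) js))"
    unfolding IH[symmetric]
    by (subst mult_four_block_mat[OF Aj _ _ A Bj _ _ B]) (use Aj A Bj B mult_carrier_mat[OF A B] in auto)
  then show ?case
    using carrier_matD[OF A] carrier_matD[OF B] carrier_matD[OF Aj] carrier_matD[OF Bj]
    by (simp add: Let_def IH[symmetric])
qed

lemma det_diag_block_mat_map:
  fixes A :: "'b \<Rightarrow> 'a :: idom mat"
  assumes "\<And>j. j \<in> set js \<Longrightarrow> A j \<in> carrier_mat (s j) (s j)"
  shows "det (diag_block_mat (map A js)) = (\<Prod>j\<leftarrow>js. det (A j))"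
  using assms
proof (induction js)
  case Nil
  show ?case by simp
next
  case (Cons j js)
  let ?S = "\<Sum>j\<leftarrow>js. s j"
  have A: "diag_block_mat (map A js) \<in> carrier_mat ?S ?S"
    using Cons.prems by (auto intro!: diag_block_mat_map_carrier)
  have Aj: "A j \<in> carrier_mat (s j) (s j)" using Cons.prems by auto
  have "det (four_block_mat (A j) (0\<^sub>m (s j) ?S) (0\<^sub>m ?S (s j)) (diag_block_mat (map A js))) =
      det (A j) * det (diag_block_mat (map A js))"
    by (rule det_four_block_mat_lower_left_zero[OF Aj _ _ A]) auto
  then show ?case
    using carrier_matD[OF A] carrier_matD[OF Aj] Cons by (simp add: Let_def)
qed

lemma diag_block_mat_map_one:
  "diag_block_mat (map (\<lambda>j. 1\<^sub>m (s j)) js) = 1\<^sub>m (\<Sum>j\<leftarrow>js. s j)"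
  using diag_block_one_mat[of "map (\<lambda>j. 1\<^sub>m (s j)) js"] by (simp add: o_def)

lemma sum_list_upt_atLeast1:
  fixes f :: "nat \<Rightarrow> 'a :: comm_monoid_add"
  shows "(\<Sum>j\<leftarrow>[1..<k + 1]. f j) = (\<Sum>j = 1..k. f j)"
  by (simp only: interv_sum_list_conv_sum_set_nat set_upt Suc_eq_plus1[symmetric]
      atLeastLessThanSuc_atLeastAtMost)

text \<open>A new block is split off at the bottom right: as block positions are counted from the
  start of a vector, the other blocks of \<open>u\<close> and \<open>v\<close> then keep their indices.\<close>

lemma scalar_prod_diag_block_mat:
  fixes u v :: "'a :: comm_ring_1 vec"
  assumes "\<And>j. j \<in> {1..k} \<Longrightarrow> A j \<in> carrier_mat (s j) (s j)"
    and "u \<in> carrier_vec (\<Sum>j = 1..k. s j)" and "v \<in> carrier_vec (\<Sum>j = 1..k. s j)"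
  shows "v \<bullet> (diag_block_mat (map A [1..<k + 1]) *\<^sub>v u) =
    (\<Sum>j = 1..k. vec_block s v j \<bullet> (A j *\<^sub>v vec_block s u j))"
  using assms
proof (induction k arbitrary: u v)
  case 0
  then show ?case by (simp add: scalar_prod_def)
next
  case (Suc k)
  let ?S = "\<Sum>j = 1..k. s j"
  let ?D = "diag_block_mat (map A [1..<k + 1])"
  have S: "(\<Sum>j\<leftarrow>[1..<k + 1]. s j) = ?S"
    by (rule sum_list_upt_atLeast1)
  have "?D \<in> carrier_mat (\<Sum>j\<leftarrow>[1..<k + 1]. s j) (\<Sum>j\<leftarrow>[1..<k + 1]. s j)"
    using Suc.prems(1) by (intro diag_block_mat_map_carrier) auto
  then have D: "?D \<in> carrier_mat ?S ?S" unfolding S .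
  have Ak: "A (Suc k) \<in> carrier_mat (s (Suc k)) (s (Suc k))" using Suc.prems(1) by auto
  have split: "vec_first x ?S @\<^sub>v vec_block s x (Suc k) = x"
    if "x \<in> carrier_vec (\<Sum>j = 1..Suc k. s j)" for x :: "'a vec"
    using that by (intro eq_vecI)
      (auto simp: vec_block_def vec_first_def atLeastLessThanSuc_atLeastAtMost)
  have blocks: "vec_block s (vec_first x ?S) j = vec_block s x j" if "j \<in> {1..k}"
    for x :: "'a vec" and j
  proof -
    have "(\<Sum>l = 1..<j. s l) + s j = (\<Sum>l \<in> insert j {1..<j}. s l)" by simp
    also have "\<dots> \<le> ?S" using that by (intro sum_mono2) auto
    finally show ?thesis by (intro eq_vecI) (auto simp: vec_block_def vec_first_def)
  qed
  have diag: "diag_block_mat (map A [1..<Suc k + 1]) =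
      four_block_mat ?D (0\<^sub>m ?S (s (Suc k))) (0\<^sub>m (s (Suc k)) ?S) (A (Suc k))"
    using D Ak by (simp add: diag_block_mat_last Let_def)
  have cf: "vec_first x ?S \<in> carrier_vec ?S" and cb: "vec_block s x j \<in> carrier_vec (s j)"
    for x :: "'a vec" and j by (auto simp: vec_block_def)
  have "v \<bullet> (diag_block_mat (map A [1..<Suc k + 1]) *\<^sub>v u) =
      (vec_first v ?S @\<^sub>v vec_block s v (Suc k)) \<bullet>
        (diag_block_mat (map A [1..<Suc k + 1]) *\<^sub>v (vec_first u ?S @\<^sub>v vec_block s u (Suc k)))"
    using Suc.prems by (simp only: split)
  also have "\<dots> = vec_first v ?S \<bullet> (?D *\<^sub>v vec_first u ?S) +
      vec_block s v (Suc k) \<bullet> (A (Suc k) *\<^sub>v vec_block s u (Suc k))"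
    unfolding diag mult_mat_vec_split[OF D Ak cf cb]
    by (rule scalar_prod_append[OF cf cb]) (use D Ak cf cb in auto)
  also have "vec_first v ?S \<bullet> (?D *\<^sub>v vec_first u ?S) =
      (\<Sum>j = 1..k. vec_block s v j \<bullet> (A j *\<^sub>v vec_block s u j))"
    using Suc.prems(1) by (subst Suc.IH) (simp_all add: blocks[simplified])
  finally show ?case by simp
qed

section \<open>Inverting the canonical form\<close>

text \<open>Only a right inverse \<open>E\<close> of \<open>U A V\<close> has to be exhibited: one-sided inverses of square
  matrices over a field are two-sided, so \<open>U (A V E) = 1\<close> gives \<open>(A V E) U = 1\<close>.\<close>

lemma mat_inverse_of_equivalent:
  fixes A :: "'a :: field mat"
  assumes A: "A \<in> carrier_mat n n" and U: "U \<in> carrier_mat n n" and V: "V \<in> carrier_mat n n"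
    and E: "E \<in> carrier_mat n n" and det: "det A \<noteq> 0" and UAV: "U * A * V * E = 1\<^sub>m n"
  shows "the (mat_inverse A) = V * E * U"
proof -
  note X = the_mat_inverse[OF A det]
  have "U * (A * (V * E)) = 1\<^sub>m n"
    using UAV A U V E by (simp add: assoc_mult_mat[of _ n n _ n _ n])
  then have "A * (V * E) * U = 1\<^sub>m n"
    using mat_mult_left_right_inverse[OF U, of "A * (V * E)"] A V E by auto
  then have right: "A * (V * E * U) = 1\<^sub>m n"
    using A U V E by (simp add: assoc_mult_mat[of _ n n _ n _ n])
  have "V * E * U = the (mat_inverse A) * A * (V * E * U)"
    using X U V E by simp
  also have "\<dots> = the (mat_inverse A) * (A * (V * E * U))"
    using X(1) A U V E by (intro assoc_mult_mat[of _ n n _ n _ n]) auto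
  also have "\<dots> = the (mat_inverse A)" using X(1) right by simp
  finally show ?thesis by simp
qed

lemma invertible_mat_det_nonzero:
  fixes A :: "'a :: field mat"
  assumes A: "A \<in> carrier_mat n n" and inv: "invertible_mat A"
  shows "det A \<noteq> 0"
proof -
  obtain B where AB: "A * B = 1\<^sub>m n" and BA: "B * A = 1\<^sub>m (dim_row B)"
    using inv A unfolding invertible_mat_def inverts_mat_def by auto
  have "dim_col B = n" using arg_cong[OF AB, of dim_col] by simp
  moreover have "dim_row B = n" using arg_cong[OF BA, of dim_col] A by simp
  ultimately have "B \<in> carrier_mat n n" by auto
  then have "det A * det B = 1" using det_mult[OF A] AB by (metis det_one)
  then show ?thesis by auto
qed

text \<open>Both parts of the canonical form are put into a single family, because the positions of
  the blocks of \<open>u\<close> and \<open>v\<close> are counted through both parts.\<close>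

definition weierstrass_block ::
  "nat \<Rightarrow> (nat \<Rightarrow> nat) \<Rightarrow> (nat \<Rightarrow> 'a :: comm_ring_1) \<Rightarrow> (nat \<Rightarrow> nat) \<Rightarrow> 'a \<Rightarrow> nat \<Rightarrow> 'a mat" where
  "weierstrass_block k0 n0 \<tau> n1 z j =
    (if j \<le> k0 then jordan_block (n0 j) (\<tau> j) - z \<cdot>\<^sub>m 1\<^sub>m (n0 j)
     else 1\<^sub>m (n1 (j - k0)) - z \<cdot>\<^sub>m shift_mat (n1 (j - k0)))"

definition weierstrass_block_inverse ::
  "nat \<Rightarrow> (nat \<Rightarrow> nat) \<Rightarrow> (nat \<Rightarrow> 'a :: field) \<Rightarrow> (nat \<Rightarrow> nat) \<Rightarrow> 'a \<Rightarrow> nat \<Rightarrow> 'a mat" where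
  "weierstrass_block_inverse k0 n0 \<tau> n1 z j =
    (if j \<le> k0 then (- 1 / (z - \<tau> j)) \<cdot>\<^sub>m shift_neumann (n0 j) (1 / (z - \<tau> j))
     else shift_neumann (n1 (j - k0)) z)"

lemma weierstrass_block_carrier [simp]:
  "weierstrass_block k0 n0 \<tau> n1 z j \<in>
    carrier_mat (block_size k0 n0 n1 j) (block_size k0 n0 n1 j)"
  by (auto simp: weierstrass_block_def block_size_def shift_mat_def)

lemma weierstrass_block_inverse_carrier [simp]:
  "weierstrass_block_inverse k0 n0 \<tau> n1 z j \<in>
    carrier_mat (block_size k0 n0 n1 j) (block_size k0 n0 n1 j)"
  by (auto simp: weierstrass_block_inverse_def block_size_def)

lemma weierstrass_block_mult_inverse:
  fixes z :: "'a :: field"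
  assumes "j \<le> k0 \<Longrightarrow> z \<noteq> \<tau> j"
  shows "weierstrass_block k0 n0 \<tau> n1 z j * weierstrass_block_inverse k0 n0 \<tau> n1 z j =
    1\<^sub>m (block_size k0 n0 n1 j)"
  using assms jordan_block_resolvent[of z "\<tau> j" "n0 j"]
  by (auto simp: weierstrass_block_def weierstrass_block_inverse_def block_size_def
      shift_neumann_inverse)

lemma upt_add_split: "[1..<k0 + k1 + 1] = [1..<k0 + 1] @ map (\<lambda>j. k0 + j) [1..<k1 + 1]"
proof -
  have "[1..<(k0 + 1) + k1] = [1..<k0 + 1] @ [k0 + 1..<(k0 + 1) + k1]"
    by (rule upt_add_eq_append) simp
  moreover have "[k0 + 1..<(k0 + 1) + k1] = map (\<lambda>j. k0 + j) [1..<k1 + 1]"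
    by (rule nth_equalityI) (auto simp del: upt_Suc)
  ultimately show ?thesis by (simp add: ac_simps)
qed

lemma sum_atLeast1_add_split:
  fixes f :: "nat \<Rightarrow> 'a :: comm_monoid_add"
  shows "(\<Sum>j = 1..k0 + k1. f j) = (\<Sum>j = 1..k0. f j) + (\<Sum>j = 1..k1. f (k0 + j))"
  by (induction k1) (simp_all add: add.assoc)

text \<open>Each of the two parts is a combination of block diagonal matrices with the same block sizes,
  hence can be formed blockwise; \<open>J(0, m)\<close> is the shift itself.\<close>

lemma weierstrass_form_diag_block_mat:
  fixes z :: "'a :: comm_ring_1"
  shows "diag_block_mat
      [jordan_matrix (map (\<lambda>j. (n0 j, \<tau> j)) [1..<k0 + 1]) - z \<cdot>\<^sub>m 1\<^sub>m (\<Sum>j = 1..k0. n0 j),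
       1\<^sub>m (\<Sum>j = 1..k1. n1 j) - z \<cdot>\<^sub>m jordan_matrix (map (\<lambda>j. (n1 j, 0)) [1..<k1 + 1])] =
    diag_block_mat (map (weierstrass_block k0 n0 \<tau> n1 z) [1..<k0 + k1 + 1])"
proof -
  have one: "1\<^sub>m (\<Sum>j = 1..k. m j) = diag_block_mat (map (\<lambda>j. 1\<^sub>m (m j)) [1..<k + 1])"
    for k and m :: "nat \<Rightarrow> nat"
    by (simp only: diag_block_mat_map_one sum_list_upt_atLeast1)
  have jordan: "jordan_matrix (map (\<lambda>j. (m j, \<mu> j)) js) =
      diag_block_mat (map (\<lambda>j. jordan_block (m j) (\<mu> j)) js)"
    for m and \<mu> :: "nat \<Rightarrow> 'a" and js
    by (simp add: jordan_matrix_def o_def)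
  have shift: "jordan_block m 0 = shift_mat m" for m
    unfolding jordan_block_eq_shift_mat by (rule eq_matI) (auto simp: shift_mat_def)
  have regular: "jordan_matrix (map (\<lambda>j. (n0 j, \<tau> j)) [1..<k0 + 1]) - z \<cdot>\<^sub>m 1\<^sub>m (\<Sum>j = 1..k0. n0 j) =
      diag_block_mat (map (weierstrass_block k0 n0 \<tau> n1 z) [1..<k0 + 1])"
    unfolding jordan one
    by (subst diag_block_mat_map_minus_smult[where s = n0])
      (auto simp: weierstrass_block_def intro!: arg_cong[of _ _ diag_block_mat] map_cong)
  have nilpotent: "1\<^sub>m (\<Sum>j = 1..k1. n1 j) - z \<cdot>\<^sub>m jordan_matrix (map (\<lambda>j. (n1 j, 0)) [1..<k1 + 1]) =
      diag_block_mat (map (weierstrass_block k0 n0 \<tau> n1 z) (map (\<lambda>j. k0 + j) [1..<k1 + 1]))"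
    unfolding jordan one
    by (subst diag_block_mat_map_minus_smult[where s = n1])
      (auto simp: weierstrass_block_def shift intro!: arg_cong[of _ _ diag_block_mat] map_cong)
  show ?thesis
    unfolding upt_add_split map_append diag_block_mat_append_pair regular nilpotent ..
qed

theorem theorem4p1:
  fixes n k0 k1 :: nat
    and T0 T1 U V :: "complex mat"
    and T :: "complex \<Rightarrow> complex mat"
    and n0 n1 :: "nat \<Rightarrow> nat" and \<tau> :: "nat \<Rightarrow> complex"
    and u v :: "complex vec" and ub vb :: "nat \<Rightarrow> complex vec"
    and \<omega> \<sigma> :: "nat \<Rightarrow> nat \<Rightarrow> complex"
    and z :: complex
  assumes T0: "T0 \<in> carrier_mat (n + 1) (n + 1)" "tridiagonal_mat T0"
    and T1: "T1 \<in> carrier_mat (n + 1) (n + 1)" "tridiagonal_mat T1"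
    and T: "\<And>z. T z = T0 - z \<cdot>\<^sub>m T1"
    and regular: "\<exists>z. det (T z) \<noteq> 0"
    and wcf: "weierstrass_form T0 T1 (n + 1) U V k0 n0 \<tau> k1 n1"
    and u: "u = U *\<^sub>v unit_vec (n + 1) 0"
    and v: "v = transpose_mat V *\<^sub>v unit_vec (n + 1) 0"
    and ub: "\<And>j. j \<in> {1..k0 + k1} \<Longrightarrow> ub j = vec_block (block_size k0 n0 n1) u j"
    and vb: "\<And>j. j \<in> {1..k0 + k1} \<Longrightarrow> vb j = vec_block (block_size k0 n0 n1) v j"
    and \<omega>: "\<And>j i. j \<in> {1..k0} \<Longrightarrow> i < n0 j \<Longrightarrow>
               \<omega> j i = vb j \<bullet> ((shift_mat (n0 j) ^\<^sub>m i) *\<^sub>v ub j)"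
    and \<sigma>: "\<And>j i. j \<in> {1..k1} \<Longrightarrow> i < n1 j \<Longrightarrow>
               \<sigma> j i = vb (k0 + j) \<bullet> ((shift_mat (n1 j) ^\<^sub>m i) *\<^sub>v ub (k0 + j))"
    and z: "det (T z) \<noteq> 0"
  shows "unit_vec (n + 1) 0 \<bullet> (the (mat_inverse (T z)) *\<^sub>v unit_vec (n + 1) 0) =
           (\<Sum>j = 1..k0. \<Sum>i < n0 j. - \<omega> j i / (z - \<tau> j) ^ (i + 1)) +
           (\<Sum>j = 1..k1. \<Sum>i < n1 j. z ^ i * \<sigma> j i)"
proof -
  let ?N = "n + 1"
  let ?e = "unit_vec ?N 0 :: complex vec"
  let ?js = "[1..<k0 + k1 + 1]"
  let ?s = "block_size k0 n0 n1"
  let ?B = "weierstrass_block k0 n0 \<tau> n1 z"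
  let ?C = "weierstrass_block_inverse k0 n0 \<tau> n1 z"
  let ?E = "diag_block_mat (map ?C ?js)"
  have U: "U \<in> carrier_mat ?N ?N" "invertible_mat U" and V: "V \<in> carrier_mat ?N ?N" "invertible_mat V"
    and pos: "\<And>j. j \<in> {1..k0} \<Longrightarrow> n0 j > 0"
    and size: "(\<Sum>j = 1..k0. n0 j) + (\<Sum>j = 1..k1. n1 j) = ?N"
    using wcf unfolding weierstrass_form_def by auto
  have UTV: "U * T z * V = diag_block_mat (map ?B ?js)"
    using wcf unfolding weierstrass_form_def T
    by (simp only: weierstrass_form_diag_block_mat)
  have Tz: "T z \<in> carrier_mat ?N ?N" using T0 T1 by (auto simp: T)
  have size': "(\<Sum>j = 1..k0 + k1. ?s j) = ?N"
    unfolding sum_atLeast1_add_split size[symmetric] by (simp add: block_size_def)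
  have "?E \<in> carrier_mat (\<Sum>j\<leftarrow>?js. ?s j) (\<Sum>j\<leftarrow>?js. ?s j)"
    by (rule diag_block_mat_map_carrier) (rule weierstrass_block_inverse_carrier)
  then have E: "?E \<in> carrier_mat ?N ?N" by (simp only: sum_list_upt_atLeast1 size')

  \<comment> \<open>\<open>T z\<close> is singular at each finite eigenvalue, so \<open>z\<close> is none of them.\<close>
  have "det (U * T z * V) = det U * det (T z) * det V"
    using U V Tz by (simp add: det_mult[of _ ?N])
  then have "det (U * T z * V) \<noteq> 0"
    using z invertible_mat_det_nonzero[OF U] invertible_mat_det_nonzero[OF V] by simp
  moreover have "det (U * T z * V) = (\<Prod>j\<leftarrow>?js. det (?B j))"
    unfolding UTV by (rule det_diag_block_mat_map) (rule weierstrass_block_carrier)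
  ultimately have dets: "det (?B j) \<noteq> 0" if "j \<in> {1..k0}" for j
    using that by (auto simp: prod_list_zero_iff simp del: upt_Suc)
  have z\<tau>: "z \<noteq> \<tau> j" if "j \<in> {1..k0}" for j
    using dets[OF that] pos[OF that] that
    by (auto simp: weierstrass_block_def det_jordan_block_minus_eigenvalue)

  have "U * T z * V * ?E = diag_block_mat (map (\<lambda>j. ?B j * ?C j) ?js)"
    unfolding UTV by (rule diag_block_mat_map_mult)
      (rule weierstrass_block_carrier weierstrass_block_inverse_carrier)+
  also have "\<dots> = diag_block_mat (map (\<lambda>j. 1\<^sub>m (?s j)) ?js)"
    using z\<tau> by (intro arg_cong[of _ _ diag_block_mat] map_cong refl weierstrass_block_mult_inverse)
      auto
  also have "\<dots> = 1\<^sub>m ?N"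
    by (simp only: diag_block_mat_map_one sum_list_upt_atLeast1 size')
  finally have inv: "the (mat_inverse (T z)) = V * ?E * U"
    by (rule mat_inverse_of_equivalent[OF Tz U(1) V(1) E z])

  have cu: "u \<in> carrier_vec ?N" and cv: "v \<in> carrier_vec ?N" using U V by (auto simp: u v)
  have cub: "vec_block ?s x j \<in> carrier_vec (?s j)" for x :: "complex vec" and j
    by (simp add: vec_block_def)
  have "?e \<bullet> (the (mat_inverse (T z)) *\<^sub>v ?e) = ?e \<bullet> (V *\<^sub>v (?E *\<^sub>v u))"
    unfolding inv u using U V E by (simp add: assoc_mult_mat_vec[of _ ?N ?N _ ?N])
  also have "\<dots> = v \<bullet> (?E *\<^sub>v u)"
    unfolding v using V E cu
    by (intro transpose_vec_mult_scalar[symmetric, of V ?N ?N]) auto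
  also have "\<dots> = (\<Sum>j = 1..k0 + k1. vec_block ?s v j \<bullet> (?C j *\<^sub>v vec_block ?s u j))"
    using cu cv by (intro scalar_prod_diag_block_mat) (simp_all only: size' weierstrass_block_inverse_carrier)
  also have "\<dots> = (\<Sum>j = 1..k0 + k1. vb j \<bullet> (?C j *\<^sub>v ub j))"
    by (intro sum.cong) (simp_all add: ub vb)
  also have "\<dots> = (\<Sum>j = 1..k0. vb j \<bullet> (?C j *\<^sub>v ub j)) +
      (\<Sum>j = 1..k1. vb (k0 + j) \<bullet> (?C (k0 + j) *\<^sub>v ub (k0 + j)))"
    by (rule sum_atLeast1_add_split)
  also have "(\<Sum>j = 1..k0. vb j \<bullet> (?C j *\<^sub>v ub j)) =
      (\<Sum>j = 1..k0. \<Sum>i < n0 j. - \<omega> j i / (z - \<tau> j) ^ (i + 1))"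
  proof (intro sum.cong refl)
    fix j assume j: "j \<in> {1..k0}"
    have c: "ub j \<in> carrier_vec (n0 j)" "vb j \<in> carrier_vec (n0 j)"
      using j cub[of _ j] by (auto simp: ub vb block_size_def)
    have C: "?C j *\<^sub>v ub j =
        (- 1 / (z - \<tau> j)) \<cdot>\<^sub>v (shift_neumann (n0 j) (1 / (z - \<tau> j)) *\<^sub>v ub j)"
      using j c by (intro eq_vecI) (auto simp: weierstrass_block_inverse_def shift_neumann_def)
    have "vb j \<bullet> (?C j *\<^sub>v ub j) =
        - 1 / (z - \<tau> j) * (vb j \<bullet> (shift_neumann (n0 j) (1 / (z - \<tau> j)) *\<^sub>v ub j))"
      unfolding C using c(2) by (intro scalar_prod_smult_right) (simp add: shift_neumann_def)
    also have "\<dots> = (\<Sum>i < n0 j. - 1 / (z - \<tau> j) * ((1 / (z - \<tau> j)) ^ i * \<omega> j i))"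
      unfolding scalar_prod_shift_neumann[OF c] sum_distrib_left using j by (simp add: \<omega>)
    also have "\<dots> = (\<Sum>i < n0 j. - \<omega> j i / (z - \<tau> j) ^ (i + 1))"
      by (intro sum.cong) (simp_all add: power_one_over)
    finally show "vb j \<bullet> (?C j *\<^sub>v ub j) = (\<Sum>i < n0 j. - \<omega> j i / (z - \<tau> j) ^ (i + 1))" .
  qed
  also have "(\<Sum>j = 1..k1. vb (k0 + j) \<bullet> (?C (k0 + j) *\<^sub>v ub (k0 + j))) =
      (\<Sum>j = 1..k1. \<Sum>i < n1 j. z ^ i * \<sigma> j i)"
  proof (intro sum.cong refl)
    fix j assume j: "j \<in> {1..k1}"
    have c: "ub (k0 + j) \<in> carrier_vec (n1 j)" "vb (k0 + j) \<in> carrier_vec (n1 j)"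
      using j cub[of _ "k0 + j"] by (auto simp: ub vb block_size_def)
    have "?C (k0 + j) = shift_neumann (n1 j) z"
      using j by (simp add: weierstrass_block_inverse_def)
    then show "vb (k0 + j) \<bullet> (?C (k0 + j) *\<^sub>v ub (k0 + j)) = (\<Sum>i < n1 j. z ^ i * \<sigma> j i)"
      using scalar_prod_shift_neumann[OF c, of z] j by (simp add: \<sigma>)
  qed
  finally show ?thesis .
qed

end
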